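(* Let $R$ be a symmetric, aperiodic, log-avoiding random walk on $\mathbb{Z}$, let $(A_n)$ be the (transient) DLA process with respect to $R$, and let $D_n=\operatorname{diam}A_n$. Then almost surely, for every constant $C$, $D_n>C^n$ for infinitely many $n$.
   Context: $R=(R_0,R_1,\dots)$ is a random walk on $\mathbb{Z}$ with i.i.d. steps distributed as an integer-valued variable $\xi$; $\mathbb{P}_x$ is its law started at $x$, and $p_{x,y}=\mathbb{P}(\xi=y-x)$. The walk is aperiodic if for all $x,y\in\mathbb{Z}$ there is $n$ with $\mathbb{P}_x(R_n=y)\ne0$. For $A\subset\mathbb{Z}$, $T_A=\min\{n>0:R_n\in A\}$ (with $\min\emptyset=\infty$). $\operatorname{diam}A=\max A-\min A$. For finite $A\subset\mathbb{Z}$ and $x\in\mathbb{Z}$ (possibly in $A$), the escape probability is $E_A(x)=\mathbb{P}_x(T_A=\infty)$ and the capacity is $\operatorname{Cap}(A)=\sum_{a\in A}E_A(a)$. The walk is log-avoiding if there is $c>0$ such that $E_A(x)\ge\frac{c}{\log|A|}$ for every finite $A\subset\mathbb{Z}$ with $|A|\ge2$ and every $x\in\mathbb{Z}$. (Such a walk is transient.) For a symmetric transient walk, finite nonempty $A$, $x\notin A$, $a\in A$, the gluing measure is $\mu(x,a;A)=\frac{p_{x,a}E_A(x)}{\operatorname{Cap}(A)}$. The DLA process with respect to $R$ is the Markov chain of random finite sets $A_0=\{0\}\subset A_1\subset A_2\subset\cdots$ such that for all $n\ge0$, finite $A\subset\mathbb{Z}$ and $x\in\mathbb{Z}\setminus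 A$, $\mathbb{P}(A_{n+1}=A\cup\{x\}\mid A_n=A)=\sum_{a\in A}\mu(x,a;A)$. *)

theory Defs
  imports "HOL-Probability.Probability"
begin

text \<open>A random walk on the integers is given by the law \<open>\<xi>\<close> of its steps;
  \<open>walk_law \<xi> x\<close> is the law on the path space of the walk started at \<open>x\<close>.\<close>

definition walk_law :: "int pmf \<Rightarrow> int \<Rightarrow> (nat \<Rightarrow> int) measure" where
  "walk_law \<xi> x =
     distr (\<Pi>\<^sub>M i\<in>UNIV. measure_pmf \<xi>) (\<Pi>\<^sub>M i\<in>UNIV. count_space UNIV)
       (\<lambda>X n. x + (\<Sum>i<n. X i))"

lemma walk_path_measurable [measurable]:
  "(\<lambda>X n. x + (\<Sum>i<n. X i)) \<in>
     (\<Pi>\<^sub>M i\<in>(UNIV::nat set). measure_pmf (\<xi> :: int pmf)) \<rightarrow>\<^sub>M (\<Pi>\<^sub>M i\<in>UNIV. count_space UNIV)"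
proof (rule measurable_PiM_single')
  fix n :: nat
  show "(\<lambda>X. x + (\<Sum>i<n. X i)) \<in> (\<Pi>\<^sub>M i\<in>(UNIV::nat set). measure_pmf \<xi>) \<rightarrow>\<^sub>M count_space UNIV"
  proof (induction n)
    case (Suc n)
    have coord: "(\<lambda>X. X n) \<in> (\<Pi>\<^sub>M i\<in>(UNIV::nat set). measure_pmf \<xi>) \<rightarrow>\<^sub>M count_space UNIV"
      using measurable_component_singleton[of n UNIV "\<lambda>_. measure_pmf \<xi>"] by simp
    have "(\<lambda>X. k + X n) \<in> (\<Pi>\<^sub>M i\<in>(UNIV::nat set). measure_pmf \<xi>) \<rightarrow>\<^sub>M count_space UNIV" for k
      by (rule measurable_compose[OF coord]) simp
    from measurable_compose_countable[OF this Suc]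
    have "(\<lambda>X. (x + (\<Sum>i<n. X i)) + X n) \<in> (\<Pi>\<^sub>M i\<in>(UNIV::nat set). measure_pmf \<xi>) \<rightarrow>\<^sub>M count_space UNIV" .
    then show ?case by (simp add: add.assoc)
  qed simp
qed auto

lemma prob_space_walk_law: "prob_space (walk_law \<xi> x)"
proof -
  interpret product_prob_space "\<lambda>_::nat. measure_pmf \<xi>" UNIV ..
  show ?thesis
    unfolding walk_law_def by (rule prob_space_distr) measurable
qed

definition step_prob :: "int pmf \<Rightarrow> int \<Rightarrow> int \<Rightarrow> real" where
  "step_prob \<xi> x y = pmf \<xi> (y - x)"

definition symmetric_walk :: "int pmf \<Rightarrow> bool" where
  "symmetric_walk \<xi> \<longleftrightarrow> (\<forall>x y. step_prob \<xi> x y = step_prob \<xi> y x)"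

definition aperiodic_walk :: "int pmf \<Rightarrow> bool" where
  "aperiodic_walk \<xi> \<longleftrightarrow> (\<forall>x y. \<exists>n. \<P>(R in walk_law \<xi> x. R n = y) \<noteq> 0)"

text \<open>The infimum of the empty set of extended naturals is \<open>\<infinity>\<close>.\<close>

definition hitting_time :: "int set \<Rightarrow> (nat \<Rightarrow> int) \<Rightarrow> enat" where
  "hitting_time A R = Inf {enat n |n. n > 0 \<and> R n \<in> A}"

definition escape_prob :: "int pmf \<Rightarrow> int set \<Rightarrow> int \<Rightarrow> real" where
  "escape_prob \<xi> A x = \<P>(R in walk_law \<xi> x. hitting_time A R = \<infinity>)"

definition capacity :: "int pmf \<Rightarrow> int set \<Rightarrow> real" where
  "capacity \<xi> A = (\<Sum>a\<in>A. escape_prob \<xi> A a)"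

definition log_avoiding :: "int pmf \<Rightarrow> bool" where
  "log_avoiding \<xi> \<longleftrightarrow>
     (\<exists>c>0. \<forall>A x. finite A \<and> card A \<ge> 2 \<longrightarrow> escape_prob \<xi> A x \<ge> c / ln (real (card A)))"

definition gluing_measure :: "int pmf \<Rightarrow> int \<Rightarrow> int \<Rightarrow> int set \<Rightarrow> real" where
  "gluing_measure \<xi> x a A = step_prob \<xi> x a * escape_prob \<xi> A x / capacity \<xi> A"

text \<open>The Markov property and the transition probabilities are required only for conditioning
  events of positive probability, since \<^const>\<open>cond_prob\<close> is \<open>0\<close> for null events.\<close>

definition DLA_process :: "int pmf \<Rightarrow> 'a measure \<Rightarrow> (nat \<Rightarrow> 'a \<Rightarrow> int set) \<Rightarrow> bool" where
  "DLA_process \<xi> M A \<longleftrightarrow>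
     prob_space M \<and>
     (\<forall>n. A n \<in> M \<rightarrow>\<^sub>M count_space {F. finite F}) \<and>
     (AE \<omega> in M. A 0 \<omega> = {0} \<and> (\<forall>n. A n \<omega> \<subseteq> A (Suc n) \<omega>)) \<and>
     (\<forall>n F G. \<P>(\<omega> in M. \<forall>i\<le>n. A i \<omega> = F i) \<noteq> 0 \<longrightarrow>
        \<P>(\<omega> in M. A (Suc n) \<omega> = G \<bar> \<forall>i\<le>n. A i \<omega> = F i) =
        \<P>(\<omega> in M. A (Suc n) \<omega> = G \<bar> A n \<omega> = F n)) \<and>
     (\<forall>n F x. finite F \<and> x \<notin> F \<and> \<P>(\<omega> in M. A n \<omega> = F) \<noteq> 0 \<longrightarrow>
        \<P>(\<omega> in M. A (Suc n) \<omega> = F \<union> {x} \<bar> A n \<omega> = F) =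
        (\<Sum>a\<in>F. gluing_measure \<xi> x a F))"

definition diam :: "int set \<Rightarrow> int" where
  "diam A = Max A - Min A"

end

theory Submission
  imports Defs
begin

text \<open>The idea: a walk started at \<open>0\<close> can avoid \<open>{-M..M}\<close> only if its first step does, so
  log-avoidance gives \<open>P(\<bar>\<xi>\<bar> > M) \<ge> c / ln (2M + 1)\<close>. By symmetry and first-step analysis the
  transition probabilities of the DLA sum to one, so \<open>A n\<close> has \<open>n + 1\<close> points. Since
  \<open>Cap F \<le> \<bar>F\<bar>\<close> and the escape probability is at least \<open>c / ln \<bar>F\<bar>\<close>, whatever the history, the
  diameter exceeds \<open>K^(n+1)\<close> at time \<open>n + 1\<close> with conditional probability at least
  \<open>c / ln (n + 1) * c / ln (2 K^(n+1) + 1)\<close>, which is of order \<open>1 / (n ln n)\<close>. This is not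
  summable, so by a conditional Borel-Cantelli argument it happens infinitely often.\<close>

section \<open>Escape probabilities and the first-step decomposition\<close>

lemma hitting_time_eq_infinity_iff: "hitting_time A R = \<infinity> \<longleftrightarrow> (\<forall>n. R (Suc n) \<notin> A)"
proof -
  have "hitting_time A R = \<infinity> \<longleftrightarrow> (\<forall>n>0. R n \<notin> A)"
    unfolding hitting_time_def top_enat_def[symmetric] Inf_top_conv
    by (auto simp: top_enat_def)
  also have "\<dots> \<longleftrightarrow> (\<forall>n. R (Suc n) \<notin> A)"
    by (metis gr0_conv_Suc)
  finally show ?thesis .
qed

abbreviation step_seq :: "int pmf \<Rightarrow> (nat \<Rightarrow> int) measure" where
  "step_seq \<xi> \<equiv> \<Pi>\<^sub>M i\<in>UNIV. measure_pmf \<xi>"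

lemma measurable_walk [measurable]:
  "(\<lambda>X. x + (\<Sum>i<n. X i)) \<in> step_seq \<xi> \<rightarrow>\<^sub>M count_space UNIV"
  using measurable_compose[OF walk_path_measurable[of x \<xi>] measurable_component_singleton[of n]]
  by simp

lemma sets_avoid [measurable]:
  fixes g :: "nat \<Rightarrow> nat"
  shows "{X \<in> space (step_seq \<xi>). \<forall>n. x + (\<Sum>i<g n. X i) \<notin> A} \<in> sets (step_seq \<xi>)"
proof (intro sets.sets_Collect_countable_All)
  fix n
  show "{X \<in> space (step_seq \<xi>). x + (\<Sum>i<g n. X i) \<notin> A} \<in> sets (step_seq \<xi>)"
    using measurable_compose[OF measurable_walk, of "\<lambda>y. y \<notin> A" "count_space UNIV" x "g n" \<xi>]
    by (simp add: pred_def)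
qed

text \<open>Moves the escape event from path space to the i.i.d. steps, where the first step can be
  split off. The sums run to \<open>Suc n\<close> because a visit at time 0 does not count.\<close>

lemma escape_prob_eq:
  "escape_prob \<xi> A x =
     measure (step_seq \<xi>) {X \<in> space (step_seq \<xi>). \<forall>n. x + (\<Sum>i<Suc n. X i) \<notin> A}"
proof -
  have "{R \<in> space (\<Pi>\<^sub>M i\<in>UNIV. count_space UNIV). \<forall>n. R (Suc n) \<notin> A}
          \<in> sets (\<Pi>\<^sub>M i\<in>(UNIV::nat set). count_space (UNIV::int set))"
    by measurable
  then show ?thesis
    unfolding escape_prob_def hitting_time_eq_infinity_iff walk_law_def
    by (subst measure_distr) (auto simp: space_PiM intro!: arg_cong[where f = "measure _"])
qed

lemma prob_space_step_seq: "prob_space (step_seq \<xi>)"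
  by (intro prob_space_PiM prob_space_measure_pmf)

lemma escape_prob_nonneg: "0 \<le> escape_prob \<xi> A x"
  by (simp add: escape_prob_eq)

lemma escape_prob_le_1: "escape_prob \<xi> A x \<le> 1"
  by (simp add: escape_prob_eq prob_space.prob_le_1[OF prob_space_step_seq])

lemma escape_prob_antimono:
  assumes "A \<subseteq> B"
  shows "escape_prob \<xi> B x \<le> escape_prob \<xi> A x"
proof -
  interpret prob_space "step_seq \<xi>"
    by (rule prob_space_step_seq)
  show ?thesis
    unfolding escape_prob_eq using assms by (intro finite_measure_mono sets_avoid) auto
qed

text \<open>The Markov property at time 1. By \<open>PiM_iter\<close> the i.i.d. sequence is a first
  step followed by an independent copy of itself, so escaping means landing at some \<open>y\<close>
  outside \<open>A\<close> and then escaping from \<open>y\<close>. The start \<open>x\<close> may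
  lie in \<open>A\<close>.\<close>

lemma escape_prob_first_step:
  "ennreal (escape_prob \<xi> A x) =
     (\<integral>\<^sup>+ y. indicator (-A) y * ennreal (escape_prob \<xi> A y) \<partial>map_pmf ((+) x) \<xi>)"
proof -
  interpret sequence_space "measure_pmf \<xi>" ..
  let ?E = "{X \<in> space S. \<forall>n. x + (\<Sum>i<Suc n. X i) \<notin> A}"
  let ?f = "\<lambda>(s, \<omega>). case_nat s \<omega> :: nat \<Rightarrow> int"
  have shift: "(\<Sum>i<Suc n. case_nat s \<omega> i) = s + (\<Sum>i<n. \<omega> i)" for s :: int and \<omega> :: "nat \<Rightarrow> int" and n
    by (subst sum.lessThan_Suc_shift) simp
  have "ennreal (escape_prob \<xi> A x) = emeasure S ?E"
    by (simp add: escape_prob_eq P.emeasure_eq_measure)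
  also have "\<dots> = emeasure (distr (measure_pmf \<xi> \<Otimes>\<^sub>M S) S ?f) ?E"
    by (simp only: PiM_iter)
  also have "\<dots> = emeasure (measure_pmf \<xi> \<Otimes>\<^sub>M S) (?f -` ?E \<inter> space (measure_pmf \<xi> \<Otimes>\<^sub>M S))"
    by (intro emeasure_distr sets_avoid) measurable
  also have "\<dots> = (\<integral>\<^sup>+ s. emeasure S (Pair s -` (?f -` ?E \<inter> space (measure_pmf \<xi> \<Otimes>\<^sub>M S))) \<partial>\<xi>)"
    by (intro P.emeasure_pair_measure_alt measurable_sets[OF _ sets_avoid]) measurable
  also have "\<dots> = (\<integral>\<^sup>+ s. indicator (-A) (x + s) * ennreal (escape_prob \<xi> A (x + s)) \<partial>\<xi>)"
  proof (intro nn_integral_cong)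
    fix s
    have "Pair s -` (?f -` ?E \<inter> space (measure_pmf \<xi> \<Otimes>\<^sub>M S)) =
        {X \<in> space S. \<forall>n. x + s + (\<Sum>i<n. X i) \<notin> A}"
      by (auto simp: space_pair_measure space_PiM shift add.assoc simp del: sum.lessThan_Suc)
    \<comment> \<open>Index \<open>n = 0\<close> is the condition on the landing point
      \<open>x + s\<close>; the other indices form the escape event from there.\<close>
    also have "\<dots> = (if x + s \<in> A then {} else {X \<in> space S. \<forall>n. x + s + (\<Sum>i<Suc n. X i) \<notin> A})"
    proof -
      have "(\<forall>n. x + s + (\<Sum>i<n. X i) \<notin> A) \<longleftrightarrow>
          x + s \<notin> A \<and> (\<forall>n. x + s + (\<Sum>i<Suc n. X i) \<notin> A)" for X
        by (metis add.right_neutral lessThan_0 not0_implies_Suc sum.empty)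
      then show ?thesis by auto
    qed
    finally show "emeasure S (Pair s -` (?f -` ?E \<inter> space (measure_pmf \<xi> \<Otimes>\<^sub>M S))) =
        indicator (-A) (x + s) * ennreal (escape_prob \<xi> A (x + s))"
      by (simp add: escape_prob_eq P.emeasure_eq_measure del: sum.lessThan_Suc)
  qed
  also have "\<dots> = (\<integral>\<^sup>+ y. indicator (-A) y * ennreal (escape_prob \<xi> A y) \<partial>map_pmf ((+) x) \<xi>)"
    by simp
  finally show ?thesis .
qed

section \<open>A divergent series\<close>

lemma not_summable_inverse_mult_ln:
  "\<not> summable (\<lambda>n. 1 / (real (n + 1) * ln (real (n + 1))))"
proof
  let ?f = "\<lambda>n. 1 / (real (n + 1) * ln (real (n + 1)))"
  assume "summable ?f"
  \<comment> \<open>Cauchy condensation leads to the harmonic series. The term at 0 is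
    \<open>1 / 0 = 0\<close>, which breaks monotonicity only there; condensation asks for it from
    index 1 on.\<close>
  then have "summable (\<lambda>n. 2 ^ n * ?f (2 ^ n))"
    by (subst condensation_test[symmetric]) (auto intro!: divide_left_mono mult_mono mult_pos_pos)
  moreover have "1 / (2 * ln 2) * inverse (real (Suc n)) \<le> 2 ^ n * ?f (2 ^ n)" for n
  proof -
    have "ln (real (2 ^ n + 1)) \<le> ln (2 ^ Suc n)"
      by (subst ln_le_cancel_iff) (auto intro: add_pos_pos)
    also have "\<dots> = real (Suc n) * ln 2"
      by (subst ln_realpow) auto
    finally have l: "ln (real (2 ^ n + 1)) \<le> real (Suc n) * ln 2" .
    have pos: "0 < ln (real (2 ^ n + 1))"
      by (rule ln_gt_zero) simp
    have "1 / (2 * ln 2) * inverse (real (Suc n)) = 2 ^ n * (1 / (2 ^ Suc n * (real (Suc n) * ln 2)))"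
      by (simp add: field_simps del: of_nat_Suc)
    also have "\<dots> \<le> 2 ^ n * ?f (2 ^ n)"
      by (intro mult_left_mono divide_left_mono mult_mono mult_pos_pos l)
         (use pos in \<open>auto intro: add_pos_pos\<close>)
    finally show ?thesis .
  qed
  ultimately have "summable (\<lambda>n. 1 / (2 * ln 2) * inverse (real (Suc n)))"
    by (elim summable_comparison_test'[where N = 0]) auto
  then have "summable (\<lambda>n. inverse (real (Suc n)))"
    by (subst (asm) summable_cmult_iff) simp
  then show False
    using not_summable_harmonic[where 'a = real] summable_Suc_iff[of "\<lambda>n. inverse (real n)"]
    by simp
qed

section \<open>Consequences of log-avoidance for single steps and escape\<close>

lemma log_avoiding_tail:
  assumes c: "c > 0" "\<And>A x. finite A \<Longrightarrow> card A \<ge> 2 \<Longrightarrow> escape_prob \<xi> A x \<ge> c / ln (real (card A))"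
    and M: "M \<ge> 1"
  shows "measure_pmf.prob \<xi> {y. \<bar>y\<bar> > int M} \<ge> c / ln (2 * real M + 1)"
proof -
  let ?A = "{- int M..int M}"
  \<comment> \<open>In the first-step identity the escape factor is at most 1; dropping it leaves
    the chance that the very first step jumps out of the interval.\<close>
  have "ennreal (escape_prob \<xi> ?A 0) \<le> (\<integral>\<^sup>+ y. indicator (-?A) y \<partial>map_pmf ((+) 0) \<xi>)"
    unfolding escape_prob_first_step[of _ _ 0]
    by (intro nn_integral_mono) (auto simp: indicator_def escape_prob_le_1)
  also have "\<dots> = ennreal (measure_pmf.prob \<xi> (-?A))"
    by (subst nn_integral_indicator) (auto simp: measure_pmf.emeasure_eq_measure intro!: arg_cong[where f = "measure_pmf.prob \<xi>"])
  also have "-?A = {y. \<bar>y\<bar> > int M}"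
    by auto
  finally have "escape_prob \<xi> ?A 0 \<le> measure_pmf.prob \<xi> {y. \<bar>y\<bar> > int M}"
    by simp
  moreover have "card ?A = 2 * M + 1"
    by simp
  then have "c / ln (2 * real M + 1) \<le> escape_prob \<xi> ?A 0"
    using c(2)[of ?A 0] M by (simp add: add.commute)
  ultimately show ?thesis by linarith
qed


text \<open>Log-avoidance is silent on sets with fewer than two points, so \<open>F\<close> is first
  enlarged by \<open>{0, 1}\<close>; a larger set is harder to avoid.\<close>

lemma escape_prob_pos:
  assumes "c > 0" "\<And>A x. finite A \<Longrightarrow> card A \<ge> 2 \<Longrightarrow> escape_prob \<xi> A x \<ge> c / ln (real (card A))"
    and "finite F"
  shows "escape_prob \<xi> F x > 0"
proof -
  have card: "card (F \<union> {0, 1}) \<ge> 2"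
    using card_mono[of "F \<union> {0, 1}" "{0, 1}"] assms(3) by simp
  then have "0 < c / ln (real (card (F \<union> {0, 1})))"
    using assms(1) by (intro divide_pos_pos ln_gt_zero) auto
  also have "\<dots> \<le> escape_prob \<xi> (F \<union> {0, 1}) x"
    using assms(2)[of "F \<union> {0, 1}"] assms(3) card by blast
  also have "\<dots> \<le> escape_prob \<xi> F x"
    by (rule escape_prob_antimono) auto
  finally show ?thesis .
qed

section \<open>Total and far mass of the gluing measure\<close>

lemma capacity_le_card: "capacity \<xi> F \<le> real (card F)"
  using sum_bounded_above[of F "escape_prob \<xi> F" 1] by (simp add: capacity_def escape_prob_le_1)

lemma capacity_nonneg: "0 \<le> capacity \<xi> F"
  by (simp add: capacity_def escape_prob_nonneg sum_nonneg)

text \<open>Symmetry turns the step from \<open>x\<close> to \<open>a\<close> into a step from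
  \<open>a\<close> to \<open>x\<close>. The mass glued inside \<open>X\<close> thus becomes a sum
  over \<open>a\<close> of first-step integrals, ready for
  \<open>escape_prob_first_step\<close>.\<close>

lemma nn_integral_gluing:
  assumes sym: "symmetric_walk \<xi>" and cap: "capacity \<xi> F > 0"
  shows "(\<integral>\<^sup>+ x. indicator X x * ennreal (\<Sum>a\<in>F. gluing_measure \<xi> x a F) \<partial>count_space UNIV) =
    (\<Sum>a\<in>F. \<integral>\<^sup>+ y. indicator X y * ennreal (escape_prob \<xi> F y) \<partial>map_pmf ((+) a) \<xi>) *
      ennreal (1 / capacity \<xi> F)"
proof -
  have shift: "step_prob \<xi> x a = pmf (map_pmf ((+) a) \<xi>) x" for x a
    using pmf_map_inj'[of "(+) a" \<xi> "x - a"] sym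
    by (simp add: symmetric_walk_def) (simp add: step_prob_def)
  have "(\<integral>\<^sup>+ x. indicator X x * ennreal (\<Sum>a\<in>F. gluing_measure \<xi> x a F) \<partial>count_space UNIV) =
    (\<integral>\<^sup>+ x. (\<Sum>a\<in>F. ennreal (pmf (map_pmf ((+) a) \<xi>) x) *
       (indicator X x * ennreal (escape_prob \<xi> F x))) * ennreal (1 / capacity \<xi> F) \<partial>count_space UNIV)"
  proof (intro nn_integral_cong)
    fix x
    have "ennreal (\<Sum>a\<in>F. gluing_measure \<xi> x a F) =
        ennreal ((\<Sum>a\<in>F. pmf (map_pmf ((+) a) \<xi>) x * escape_prob \<xi> F x) * (1 / capacity \<xi> F))"
      by (simp add: gluing_measure_def shift sum_divide_distrib)
    also have "\<dots> = (\<Sum>a\<in>F. ennreal (pmf (map_pmf ((+) a) \<xi>) x) * ennreal (escape_prob \<xi> F x)) *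
        ennreal (1 / capacity \<xi> F)"
      using cap
      by (subst ennreal_mult)
         (auto simp: sum_nonneg escape_prob_nonneg ennreal_mult sum_ennreal[symmetric]
               simp del: sum_ennreal)
    finally show "indicator X x * ennreal (\<Sum>a\<in>F. gluing_measure \<xi> x a F) =
       (\<Sum>a\<in>F. ennreal (pmf (map_pmf ((+) a) \<xi>) x) *
         (indicator X x * ennreal (escape_prob \<xi> F x))) * ennreal (1 / capacity \<xi> F)"
      by (simp add: indicator_def)
  qed
  also have "\<dots> = (\<Sum>a\<in>F. \<integral>\<^sup>+ y. indicator X y * ennreal (escape_prob \<xi> F y) \<partial>map_pmf ((+) a) \<xi>) *
      ennreal (1 / capacity \<xi> F)"
    unfolding nn_integral_measure_pmf
    by (simp add: nn_integral_multc nn_integral_sum del: sum_ennreal)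
  finally show ?thesis .
qed

text \<open>For \<open>X = -F\<close> each summand is the right side of the first-step identity, so
  the sum is the capacity and cancels the normalisation.\<close>

lemma nn_integral_gluing_total:
  assumes "symmetric_walk \<xi>" "capacity \<xi> F > 0"
  shows "(\<integral>\<^sup>+ x. indicator (-F) x * ennreal (\<Sum>a\<in>F. gluing_measure \<xi> x a F) \<partial>count_space UNIV) = 1"
proof -
  have "(\<Sum>a\<in>F. \<integral>\<^sup>+ y. indicator (-F) y * ennreal (escape_prob \<xi> F y) \<partial>map_pmf ((+) a) \<xi>) =
      (\<Sum>a\<in>F. ennreal (escape_prob \<xi> F a))"
    by (intro sum.cong refl escape_prob_first_step[symmetric])
  also have "\<dots> = ennreal (capacity \<xi> F)"
    by (simp add: capacity_def escape_prob_nonneg)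
  finally have "(\<integral>\<^sup>+ x. indicator (-F) x * ennreal (\<Sum>a\<in>F. gluing_measure \<xi> x a F) \<partial>count_space UNIV) =
      ennreal (capacity \<xi> F) * ennreal (1 / capacity \<xi> F)"
    by (simp only: nn_integral_gluing[OF assms])
  also have "\<dots> = ennreal (capacity \<xi> F * (1 / capacity \<xi> F))"
    using assms(2) by (intro ennreal_mult[symmetric]) auto
  finally show ?thesis
    using assms(2) by simp
qed

lemma dist_le_diam:
  assumes "finite B" "x \<in> B" "y \<in> B"
  shows "\<bar>x - y\<bar> \<le> diam B"
proof -
  have "x \<le> Max B" "y \<le> Max B" "Min B \<le> x" "Min B \<le> y"
    using assms by auto
  then show ?thesis
    by (simp add: diam_def abs_le_iff)
qed

text \<open>Every \<open>a\<close> in \<open>F\<close> contributes at least the escape bound times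
  the tail of the step law; since the capacity is at most \<open>card F\<close>, summing over
  \<open>a\<close> compensates the division by it.\<close>

lemma nn_integral_gluing_far:
  assumes sym: "symmetric_walk \<xi>"
    and c: "c > 0" "\<And>A x. finite A \<Longrightarrow> card A \<ge> 2 \<Longrightarrow> escape_prob \<xi> A x \<ge> c / ln (real (card A))"
    and F: "finite F" "card F \<ge> 2" "diam F \<le> t"
  shows "ennreal (c / ln (real (card F)) * measure_pmf.prob \<xi> {y. \<bar>y\<bar> > t}) \<le>
    (\<integral>\<^sup>+ x. indicator {x. x \<notin> F \<and> diam (insert x F) > t} x *
       ennreal (\<Sum>a\<in>F. gluing_measure \<xi> x a F) \<partial>count_space UNIV)"
proof -
  let ?X = "{x. x \<notin> F \<and> diam (insert x F) > t}"
  let ?e = "c / ln (real (card F))" and ?p = "measure_pmf.prob \<xi> {y. \<bar>y\<bar> > t}"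
  have e: "?e > 0"
    using c(1) F by (intro divide_pos_pos ln_gt_zero) auto
  obtain a0 where a0: "a0 \<in> F"
    using F by fastforce
  have "0 < escape_prob \<xi> F a0"
    by (rule escape_prob_pos[OF c F(1)])
  also have "\<dots> \<le> capacity \<xi> F"
    unfolding capacity_def using F a0 by (intro member_le_sum escape_prob_nonneg)
  finally have cap: "capacity \<xi> F > 0" .
  have each: "ennreal (?e * ?p) \<le>
      (\<integral>\<^sup>+ y. indicator ?X y * ennreal (escape_prob \<xi> F y) \<partial>map_pmf ((+) a) \<xi>)" if a: "a \<in> F" for a
  proof -
    \<comment> \<open>A jump longer than \<open>t\<close>, hence longer than the diameter of
      \<open>F\<close>, leaves \<open>F\<close> and stretches the diameter past
      \<open>t\<close>.\<close>
    have X: "a + s \<in> ?X" if "\<bar>s\<bar> > t" for s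
    proof -
      have "a + s \<notin> F"
        using dist_le_diam[OF F(1), of "a + s" a] F(3) a that by auto
      moreover have "\<bar>s\<bar> \<le> diam (insert (a + s) F)"
        using dist_le_diam[of "insert (a + s) F" "a + s" a] F(1) a by simp
      ultimately show ?thesis using that by auto
    qed
    have "ennreal (?e * ?p) = (\<integral>\<^sup>+ s. ennreal ?e * indicator {y. \<bar>y\<bar> > t} s \<partial>\<xi>)"
      using ennreal_mult[of ?e ?p] e by (simp add: nn_integral_cmult measure_pmf.emeasure_eq_measure)
    also have "\<dots> \<le> (\<integral>\<^sup>+ s. indicator ?X (a + s) * ennreal (escape_prob \<xi> F (a + s)) \<partial>\<xi>)"
      using X c(2)[OF F(1,2)] by (intro nn_integral_mono) (auto simp: indicator_def intro: ennreal_leI)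
    finally show ?thesis by simp
  qed
  have "1 \<le> real (card F) * (1 / capacity \<xi> F)"
    using capacity_le_card[of \<xi> F] cap by (simp add: field_simps)
  then have "1 * (?e * ?p) \<le> real (card F) * (1 / capacity \<xi> F) * (?e * ?p)"
    using e by (intro mult_right_mono mult_nonneg_nonneg) (auto simp: less_imp_le)
  then have "?e * ?p \<le> real (card F) * (?e * ?p) * (1 / capacity \<xi> F)"
    by (simp only: ac_simps mult_1)
  then have "ennreal (?e * ?p) \<le> ennreal (real (card F) * (?e * ?p) * (1 / capacity \<xi> F))"
    by (rule ennreal_leI)
  also have "\<dots> = (\<Sum>a\<in>F. ennreal (?e * ?p)) * ennreal (1 / capacity \<xi> F)"
  proof -
    have ep: "0 \<le> ?e * ?p"
      using e by (intro mult_nonneg_nonneg) (auto simp: less_imp_le)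
    then have eq: "(\<Sum>a\<in>F. ennreal (?e * ?p)) = ennreal (real (card F) * (?e * ?p))"
      by (subst sum_ennreal) simp_all
    show ?thesis
      unfolding eq using cap
      by (intro ennreal_mult mult_nonneg_nonneg[OF of_nat_0_le_iff ep]) simp
  qed
  also have "\<dots> \<le> (\<Sum>a\<in>F. \<integral>\<^sup>+ y. indicator ?X y * ennreal (escape_prob \<xi> F y) \<partial>map_pmf ((+) a) \<xi>) *
      ennreal (1 / capacity \<xi> F)"
    by (intro mult_right_mono sum_mono each) auto
  finally show ?thesis
    by (simp only: nn_integral_gluing[OF sym cap])
qed

section \<open>The DLA conditioned on its history\<close>

locale log_avoiding_DLA = prob_space M for M :: "'a measure" +
  fixes \<xi> :: "int pmf" and A :: "nat \<Rightarrow> 'a \<Rightarrow> int set" and c :: real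
  assumes sym: "symmetric_walk \<xi>"
    and c: "c > 0" "\<And>F x. finite F \<Longrightarrow> card F \<ge> 2 \<Longrightarrow> escape_prob \<xi> F x \<ge> c / ln (real (card F))"
    and dla: "DLA_process \<xi> M A"
begin

lemma measurable_A_finite: "A n \<in> M \<rightarrow>\<^sub>M count_space {F. finite F}"
  and AE_incseq_A: "AE \<omega> in M. A 0 \<omega> = {0} \<and> (\<forall>n. A n \<omega> \<subseteq> A (Suc n) \<omega>)"
  using dla unfolding DLA_process_def by blast+

lemma finite_A: "\<omega> \<in> space M \<Longrightarrow> finite (A n \<omega>)"
  using measurable_space[OF measurable_A_finite] by simp

text \<open>With the discrete sigma-algebra on all sets as target, every predicate of
  \<open>A n\<close> becomes measurable.\<close>

lemma measurable_A [measurable]: "A n \<in> M \<rightarrow>\<^sub>M count_space UNIV"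
proof (rule measurableI)
  fix X :: "int set set"
  have "A n -` X \<inter> space M = A n -` (X \<inter> {F. finite F}) \<inter> space M"
    using finite_A by auto
  also have "\<dots> \<in> sets M"
    by (rule measurable_sets[OF measurable_A_finite]) auto
  finally show "A n -` X \<inter> space M \<in> sets M" .
qed auto

text \<open>The whole past is fixed, not only \<open>A n\<close>, because the growth events below
  depend on several earlier times. Only the values of \<open>F\<close> up to \<open>n\<close>
  matter.\<close>

definition hist :: "nat \<Rightarrow> (nat \<Rightarrow> int set) \<Rightarrow> 'a set" where
  "hist n F = {\<omega> \<in> space M. \<forall>i\<le>n. A i \<omega> = F i}"

lemma sets_hist [measurable]: "hist n F \<in> sets M"
  unfolding hist_def by measurable

text \<open>Markov property and transition rule combined. The product form also covers null
  histories, where both sides vanish.\<close>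

lemma prob_hist_step:
  assumes "finite (F n)" "x \<notin> F n"
  shows "prob (hist n F \<inter> {\<omega> \<in> space M. A (Suc n) \<omega> = insert x (F n)}) =
    prob (hist n F) * (\<Sum>a\<in>F n. gluing_measure \<xi> x a (F n))"
proof (cases "prob (hist n F) = 0")
  case True
  have "prob (hist n F \<inter> {\<omega> \<in> space M. A (Suc n) \<omega> = insert x (F n)}) \<le> prob (hist n F)"
    by (intro finite_measure_mono) auto
  with True show ?thesis
    by (simp add: measure_le_0_iff)
next
  case False
  \<comment> \<open>The transition rule needs positive probability of the present state, which it
    inherits from the history.\<close>
  have "prob (hist n F) \<le> prob {\<omega> \<in> space M. A n \<omega> = F n}"
    by (intro finite_measure_mono) (auto simp: hist_def)
  with False have "prob {\<omega> \<in> space M. A n \<omega> = F n} \<noteq> 0"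
    by (metis measure_le_0_iff)
  with assms dla have "\<P>(\<omega> in M. A (Suc n) \<omega> = F n \<union> {x} \<bar> A n \<omega> = F n) =
      (\<Sum>a\<in>F n. gluing_measure \<xi> x a (F n))"
    unfolding DLA_process_def by blast
  moreover from False dla have "\<P>(\<omega> in M. A (Suc n) \<omega> = F n \<union> {x} \<bar> \<forall>i\<le>n. A i \<omega> = F i) =
        \<P>(\<omega> in M. A (Suc n) \<omega> = F n \<union> {x} \<bar> A n \<omega> = F n)"
    unfolding DLA_process_def hist_def by blast
  ultimately have "prob {\<omega> \<in> space M. A (Suc n) \<omega> = F n \<union> {x} \<and> (\<forall>i\<le>n. A i \<omega> = F i)} =
      prob (hist n F) * (\<Sum>a\<in>F n. gluing_measure \<xi> x a (F n))"
    using False by (simp add: cond_prob_def hist_def field_simps)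
  moreover have "{\<omega> \<in> space M. A (Suc n) \<omega> = F n \<union> {x} \<and> (\<forall>i\<le>n. A i \<omega> = F i)} =
      hist n F \<inter> {\<omega> \<in> space M. A (Suc n) \<omega> = insert x (F n)}"
    by (auto simp: hist_def)
  ultimately show ?thesis by simp
qed

text \<open>Different \<open>x\<close> outside \<open>F n\<close> give different sets
  \<open>insert x (F n)\<close>, so countable additivity applies.\<close>

lemma emeasure_hist_step:
  assumes F: "finite (F n)" and X: "X \<subseteq> - F n"
  shows "emeasure M (hist n F \<inter> {\<omega> \<in> space M. \<exists>x\<in>X. A (Suc n) \<omega> = insert x (F n)}) =
    emeasure M (hist n F) *
      (\<integral>\<^sup>+ x. indicator X x * ennreal (\<Sum>a\<in>F n. gluing_measure \<xi> x a (F n)) \<partial>count_space UNIV)"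
proof -
  let ?E = "\<lambda>x. hist n F \<inter> {\<omega> \<in> space M. A (Suc n) \<omega> = insert x (F n)}"
  let ?g = "\<lambda>x. \<Sum>a\<in>F n. gluing_measure \<xi> x a (F n)"
  have "hist n F \<inter> {\<omega> \<in> space M. \<exists>x\<in>X. A (Suc n) \<omega> = insert x (F n)} = (\<Union>x\<in>X. ?E x)"
    by auto
  also have "emeasure M \<dots> = (\<integral>\<^sup>+ x. emeasure M (?E x) \<partial>count_space X)"
    using X by (intro emeasure_UN_countable) (auto simp: disjoint_family_on_def)
  also have "\<dots> = (\<integral>\<^sup>+ x. emeasure M (?E x) * indicator X x \<partial>count_space UNIV)"
    by (subst nn_integral_count_space_indicator) auto
  also have "\<dots> = (\<integral>\<^sup>+ x. emeasure M (hist n F) * (indicator X x * ennreal (?g x)) \<partial>count_space UNIV)"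
  proof (intro nn_integral_cong)
    fix x
    have "0 \<le> ?g x"
      by (intro sum_nonneg)
         (simp add: gluing_measure_def step_prob_def escape_prob_nonneg capacity_nonneg)
    then have "emeasure M (?E x) = emeasure M (hist n F) * ennreal (?g x)" if "x \<in> X"
      using prob_hist_step[of F n x] F X that
      by (subst emeasure_eq_measure) (auto simp: emeasure_eq_measure ennreal_mult)
    then show "emeasure M (?E x) * indicator X x =
        emeasure M (hist n F) * (indicator X x * ennreal (?g x))"
      by (auto simp: indicator_def)
  qed
  also have "\<dots> = emeasure M (hist n F) *
      (\<integral>\<^sup>+ x. indicator X x * ennreal (?g x) \<partial>count_space UNIV)"
    by (rule nn_integral_cmult) auto
  finally show ?thesis .
qed

text \<open>Histories are indexed by lists because there are only countably many lists of finite sets.\<close>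

lemma emeasure_eq_nn_integral_hist:
  assumes [measurable]: "E \<in> sets M"
  shows "emeasure M E =
    (\<integral>\<^sup>+ h. emeasure M (E \<inter> hist n ((!) h)) \<partial>count_space {h \<in> lists {F. finite F}. length h = Suc n})"
    (is "_ = (\<integral>\<^sup>+ h. _ \<partial>count_space ?I)")
proof -
  have eq: "\<omega> \<in> hist n ((!) h) \<longleftrightarrow> \<omega> \<in> space M \<and> h = map (\<lambda>i. A i \<omega>) [0..<Suc n]"
    if "h \<in> ?I" for h \<omega>
    using that by (auto simp: hist_def list_eq_iff_nth_eq less_Suc_eq_le simp del: upt_Suc)
  have "countable ?I"
    by (rule countable_subset[of _ "lists {F. finite F}"])
       (auto intro!: countable_lists countable_Collect_finite)
  moreover have "disjoint_family_on (\<lambda>h. E \<inter> hist n ((!) h)) ?I"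
    unfolding disjoint_family_on_def
  proof (intro ballI impI)
    fix h h' assume "h \<in> ?I" "h' \<in> ?I" "h \<noteq> h'"
    then show "(E \<inter> hist n ((!) h)) \<inter> (E \<inter> hist n ((!) h')) = {}"
      using eq[of h] eq[of h'] by auto
  qed
  moreover have "(\<Union>h\<in>?I. E \<inter> hist n ((!) h)) = E"
  proof
    show "E \<subseteq> (\<Union>h\<in>?I. E \<inter> hist n ((!) h))"
    proof
      fix \<omega> assume \<omega>: "\<omega> \<in> E"
      then have sp: "\<omega> \<in> space M"
        using sets.sets_into_space[OF assms] by auto
      then have I: "map (\<lambda>i. A i \<omega>) [0..<Suc n] \<in> ?I"
        by (auto simp: finite_A)
      with sp \<omega> show "\<omega> \<in> (\<Union>h\<in>?I. E \<inter> hist n ((!) h))"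
        using eq[OF I, of \<omega>] by blast
    qed
  qed auto
  ultimately show ?thesis
    using emeasure_UN_countable[of ?I "\<lambda>h. E \<inter> hist n ((!) h)" M] by simp
qed

text \<open>Law of total probability: a bound that holds given each history up to \<open>n\<close>
  holds unconditionally. It is applied with \<open>q = 0\<close> and with \<open>q\<close> the
  conditional failure probability.\<close>

lemma emeasure_le_hist:
  assumes [measurable]: "E \<in> sets M" "E' \<in> sets M"
    and le: "\<And>F. (\<And>i. i \<le> n \<Longrightarrow> finite (F i)) \<Longrightarrow>
      emeasure M (E \<inter> hist n F) \<le> q * emeasure M (E' \<inter> hist n F)"
  shows "emeasure M E \<le> q * emeasure M E'"
proof -
  have fin: "finite (h ! i)" if "h \<in> {h \<in> lists {F. finite F}. length h = Suc n}" "i \<le> n" for h :: "int set list" and i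
    using that by (auto simp: in_lists_conv_set less_Suc_eq_le)
  show ?thesis
    unfolding emeasure_eq_nn_integral_hist[OF assms(1), of n] emeasure_eq_nn_integral_hist[OF assms(2), of n]
    by (subst nn_integral_cmult[symmetric]) (auto intro!: nn_integral_mono le fin)
qed

lemma AE_zero_mem: "AE \<omega> in M. \<forall>n. 0 \<in> A n \<omega>"
proof -
  show ?thesis
    using AE_incseq_A
  proof (eventually_elim, intro allI)
    fix \<omega> n assume *: "A 0 \<omega> = {0} \<and> (\<forall>n. A n \<omega> \<subseteq> A (Suc n) \<omega>)"
    then show "0 \<in> A n \<omega>"
      by (induction n) auto
  qed
qed

text \<open>Lets arguments by history discard those whose last set violates an almost sure property,
  such as containing 0 or having \<open>Suc n\<close> points.\<close>

lemma hist_null_if: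
  assumes "AE \<omega> in M. P (A n \<omega>)" "\<not> P (F n)"
  shows "emeasure M (hist n F) = 0"
proof -
  have "AE \<omega> in M. \<omega> \<notin> hist n F"
    using assms(1) by eventually_elim (use assms(2) in \<open>auto simp: hist_def\<close>)
  then show ?thesis
    using AE_iff_null_sets[OF sets_hist, of n F] by auto
qed

text \<open>The gluing probabilities outside \<open>F n\<close> sum to one, so given any history
  nothing is left for other transitions.\<close>

lemma AE_insert: "AE \<omega> in M. \<exists>x. x \<notin> A n \<omega> \<and> A (Suc n) \<omega> = insert x (A n \<omega>)"
proof -
  let ?E = "{\<omega> \<in> space M. \<not> (\<exists>x. x \<notin> A n \<omega> \<and> A (Suc n) \<omega> = insert x (A n \<omega>))}"
  have E [measurable]: "?E \<in> sets M"
  proof -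
    \<comment> \<open>The event couples \<open>A n\<close> and \<open>A (Suc n)\<close>; splitting
      over the countably many finite values of \<open>A n\<close> makes it measurable.\<close>
    have "{\<omega> \<in> space M. \<exists>F\<in>{F. finite F}. A n \<omega> = F \<and> \<not> (\<exists>x. x \<notin> F \<and> A (Suc n) \<omega> = insert x F)} \<in> sets M"
      by (intro sets.sets_Collect_countable_Ex' countable_Collect_finite) measurable
    also have "{\<omega> \<in> space M. \<exists>F\<in>{F. finite F}. A n \<omega> = F \<and> \<not> (\<exists>x. x \<notin> F \<and> A (Suc n) \<omega> = insert x F)} = ?E"
      by (auto simp: finite_A)
    finally show ?thesis .
  qed
  have "emeasure M ?E \<le> 0 * emeasure M (space M)"
  proof (rule emeasure_le_hist[where n = n])
    fix F :: "nat \<Rightarrow> int set" assume fin: "\<And>i. i \<le> n \<Longrightarrow> finite (F i)"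
    have "emeasure M (?E \<inter> hist n F) = 0"
    proof (cases "0 \<in> F n")
      case False
      have "emeasure M (?E \<inter> hist n F) \<le> emeasure M (hist n F)"
        by (intro emeasure_mono) auto
      also have "emeasure M (hist n F) = 0"
        by (rule hist_null_if[of "\<lambda>B. 0 \<in> B"]) (use AE_zero_mem False in auto)
      finally show ?thesis by simp
    next
      case True
      let ?G = "{\<omega> \<in> space M. \<exists>x\<in>- F n. A (Suc n) \<omega> = insert x (F n)}"
      have [measurable]: "?G \<in> sets M" by measurable
      \<comment> \<open>The point 0 supplies one positive summand of the capacity, so the total-mass
        identity applies.\<close>
      have "0 < escape_prob \<xi> (F n) 0"
        by (rule escape_prob_pos[OF c]) (use fin in auto)
      also have "\<dots> \<le> capacity \<xi> (F n)"
        unfolding capacity_def using fin True by (intro member_le_sum escape_prob_nonneg) auto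
      finally have "emeasure M (hist n F \<inter> ?G) = emeasure M (hist n F)"
        using fin by (simp add: emeasure_hist_step nn_integral_gluing_total[OF sym])
      moreover have "emeasure M (hist n F - hist n F \<inter> ?G) =
          emeasure M (hist n F) - emeasure M (hist n F \<inter> ?G)"
        by (rule emeasure_Diff) auto
      moreover have "emeasure M (?E \<inter> hist n F) \<le> emeasure M (hist n F - hist n F \<inter> ?G)"
        by (rule emeasure_mono) (auto simp: hist_def)
      ultimately show ?thesis by simp
    qed
    then show "emeasure M (?E \<inter> hist n F) \<le> 0 * emeasure M (space M \<inter> hist n F)"
      by simp
  qed (rule E, rule sets.top)
  then have "?E \<in> null_sets M"
    using E by (intro null_setsI) simp_all
  then show ?thesis
    by (rule AE_I') auto
qed

lemma AE_card: "AE \<omega> in M. \<forall>n. card (A n \<omega>) = Suc n"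
proof -
  have "AE \<omega> in M. A 0 \<omega> = {0}"
    using AE_incseq_A by eventually_elim blast
  moreover have "AE \<omega> in M. \<forall>n. \<exists>x. x \<notin> A n \<omega> \<and> A (Suc n) \<omega> = insert x (A n \<omega>)"
    using AE_insert by (simp add: AE_all_countable)
  ultimately show ?thesis
    using AE_space
  proof (eventually_elim, intro allI)
    fix \<omega> n
    assume *: "A 0 \<omega> = {0}" "\<forall>n. \<exists>x. x \<notin> A n \<omega> \<and> A (Suc n) \<omega> = insert x (A n \<omega>)" "\<omega> \<in> space M"
    show "card (A n \<omega>) = Suc n"
    proof (induction n)
      case (Suc n)
      obtain x where "x \<notin> A n \<omega>" "A (Suc n) \<omega> = insert x (A n \<omega>)"
        using spec[OF *(2), of n] by (elim exE conjE)
      then show ?case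
        using finite_A[OF *(3)] Suc.IH by (simp only: card_insert_disjoint not_False_eq_True)
    qed (use *(1) in simp)
  qed
qed

section \<open>Growth of the diameter by a conditional Borel-Cantelli argument\<close>

text \<open>The first factor bounds escape from a set of \<open>n + 1\<close> points, the second the
  tail of a step beyond \<open>K ^ Suc n\<close>. At \<open>n = 0\<close> division by
  \<open>ln 1 = 0\<close> makes it 0.\<close>

definition success_bound :: "nat \<Rightarrow> nat \<Rightarrow> real" where
  "success_bound K n = c / ln (real (n + 1)) * (c / ln (2 * real (K ^ Suc n) + 1))"

text \<open>The horizon \<open>m + k\<close> is finite so that membership is decided by the history
  up to that time.\<close>

definition slow :: "nat \<Rightarrow> nat \<Rightarrow> nat \<Rightarrow> 'a set" where
  "slow K m k = {\<omega> \<in> space M. \<forall>i\<in>{m..m + k}. diam (A i \<omega>) \<le> int (K ^ i)}"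

lemma sets_slow [measurable]: "slow K m k \<in> sets M"
proof -
  have "{\<omega> \<in> space M. diam (A i \<omega>) \<le> int (K ^ i)} \<in> sets M" for i
    using measurable_compose[OF measurable_A, of "\<lambda>B. diam B \<le> int (K ^ i)" "count_space UNIV" i]
    by (simp add: pred_def)
  then show ?thesis
    unfolding slow_def by (intro sets.sets_Collect_finite_All) auto
qed

lemma step_tail:
  assumes "K \<ge> 2"
  shows "c / ln (2 * real (K ^ Suc n) + 1) \<le> measure_pmf.prob \<xi> {y. \<bar>y\<bar> > int (K ^ Suc n)}"
proof (rule log_avoiding_tail[OF c])
  show "1 \<le> K ^ Suc n"
    using assms by (intro one_le_power) simp
qed

lemma success_bound_bounds:
  assumes K: "K \<ge> 2" and n: "n \<ge> 1"
  shows "0 \<le> success_bound K n" "success_bound K n \<le> 1"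
proof -
  have nn: "0 \<le> c / ln (real (n + 1))" "0 \<le> c / ln (2 * real (K ^ Suc n) + 1)"
    using c(1) K by (auto intro!: divide_nonneg_nonneg)
  show "0 \<le> success_bound K n"
    unfolding success_bound_def by (rule mult_nonneg_nonneg[OF nn])
  \<comment> \<open>The quotient is a lower bound for the escape probability of a set with
    \<open>n + 1\<close> points, hence at most 1.\<close>
  have "c / ln (real (n + 1)) \<le> 1"
    using order_trans[OF c(2)[of "{0..int n}" 0] escape_prob_le_1] n by (simp add: nat_add_distrib)
  moreover have "c / ln (2 * real (K ^ Suc n) + 1) \<le> 1"
    using step_tail[OF K, of n] measure_pmf.prob_le_1 by (rule order_trans)
  ultimately show "success_bound K n \<le> 1"
    unfolding success_bound_def by (rule mult_le_one[OF _ nn(2)])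
qed

text \<open>Since \<open>K ^ n\<close> is at most \<open>K ^ Suc n\<close>, the far-jump bound
  applies with \<open>t = K ^ Suc n\<close>; such a jump excludes a slow next step. Histories with a
  wrong number of points are null.\<close>

lemma emeasure_hist_slow:
  assumes K: "K \<ge> 2" and n: "n \<ge> 1"
    and fin: "finite (F n)" and slow: "diam (F n) \<le> int (K ^ n)"
  shows "emeasure M (hist n F \<inter> {\<omega> \<in> space M. diam (A (Suc n) \<omega>) \<le> int (K ^ Suc n)}) \<le>
    ennreal (1 - success_bound K n) * emeasure M (hist n F)"
proof (cases "card (F n) = Suc n")
  case False
  have "emeasure M (hist n F \<inter> {\<omega> \<in> space M. diam (A (Suc n) \<omega>) \<le> int (K ^ Suc n)}) \<le> emeasure M (hist n F)"
    by (intro emeasure_mono) auto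
  also have "emeasure M (hist n F) = 0"
    by (rule hist_null_if[of "\<lambda>B. card B = Suc n"]) (use AE_card False in auto)
  finally show ?thesis by simp
next
  case True
  let ?t = "int (K ^ Suc n)" and ?q = "success_bound K n"
  let ?X = "{x. x \<notin> F n \<and> diam (insert x (F n)) > ?t}"
  let ?S = "{\<omega> \<in> space M. \<exists>x\<in>?X. A (Suc n) \<omega> = insert x (F n)}"
  let ?D = "{\<omega> \<in> space M. diam (A (Suc n) \<omega>) \<le> ?t}"
  have [measurable]: "?S \<in> sets M" by measurable
  have "K ^ n \<le> K ^ Suc n"
    using K by (intro power_increasing) auto
  with slow have t: "diam (F n) \<le> ?t"
    by linarith
  have "?q \<le> c / ln (real (card (F n))) * measure_pmf.prob \<xi> {y. \<bar>y\<bar> > ?t}"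
    unfolding success_bound_def using step_tail[OF K, of n] c(1) n True
    by (intro mult_mono) (auto intro!: divide_nonneg_nonneg)
  then have "ennreal ?q \<le> ennreal (c / ln (real (card (F n))) * measure_pmf.prob \<xi> {y. \<bar>y\<bar> > ?t})"
    by (rule ennreal_leI)
  also have "\<dots> \<le> (\<integral>\<^sup>+ x. indicator ?X x * ennreal (\<Sum>a\<in>F n. gluing_measure \<xi> x a (F n)) \<partial>count_space UNIV)"
    using True n by (intro nn_integral_gluing_far sym c fin t) auto
  finally have "emeasure M (hist n F) * ennreal ?q \<le> emeasure M (hist n F \<inter> ?S)"
    using fin by (subst emeasure_hist_step) (auto intro!: mult_left_mono)
  then have S: "prob (hist n F) * ?q \<le> prob (hist n F \<inter> ?S)"
    using success_bound_bounds[OF K n] by (simp add: emeasure_eq_measure ennreal_mult[symmetric])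
  have "prob (hist n F \<inter> ?D) \<le> prob (hist n F - hist n F \<inter> ?S)"
    by (intro finite_measure_mono) auto
  also have "\<dots> = prob (hist n F) - prob (hist n F \<inter> ?S)"
    by (rule finite_measure_Diff) auto
  also have "\<dots> \<le> (1 - ?q) * prob (hist n F)"
    using S by (simp add: algebra_simps)
  finally show ?thesis
    using success_bound_bounds[OF K n] by (simp add: emeasure_eq_measure ennreal_mult[symmetric])
qed

text \<open>A history that is slow from \<open>m\<close> to \<open>m + k\<close> gives the
  conditional bound; any other history is disjoint from the left-hand event.\<close>

lemma prob_slow_Suc:
  assumes K: "K \<ge> 2" and m: "m \<ge> 1"
  shows "prob (slow K m (Suc k)) \<le> (1 - success_bound K (m + k)) * prob (slow K m k)"
proof -
  define n where "n = m + k"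
  have n: "n \<ge> 1" using m by (simp add: n_def)
  have "emeasure M (slow K m (Suc k)) \<le> ennreal (1 - success_bound K n) * emeasure M (slow K m k)"
  proof (rule emeasure_le_hist[where n = n])
    fix F :: "nat \<Rightarrow> int set" assume fin: "\<And>i. i \<le> n \<Longrightarrow> finite (F i)"
    let ?D = "{\<omega> \<in> space M. diam (A (Suc n) \<omega>) \<le> int (K ^ Suc n)}"
    show "emeasure M (slow K m (Suc k) \<inter> hist n F) \<le>
        ennreal (1 - success_bound K n) * emeasure M (slow K m k \<inter> hist n F)"
    proof (cases "\<forall>i\<in>{m..n}. diam (F i) \<le> int (K ^ i)")
      case True
      then have "slow K m k \<inter> hist n F = hist n F"
        by (auto simp: slow_def hist_def n_def)
      moreover have "{m..m + Suc k} = insert (Suc n) {m..n}"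
        by (auto simp: n_def)
      then have "slow K m (Suc k) \<inter> hist n F = hist n F \<inter> ?D"
        using True unfolding slow_def by (auto simp: hist_def simp del: power_Suc)
      moreover have "diam (F n) \<le> int (K ^ n)"
        using True by (simp add: n_def)
      ultimately show ?thesis
        using emeasure_hist_slow[of K n F] K n fin by simp
    next
      case False
      then obtain i where "i \<in> {m..n}" "\<not> diam (F i) \<le> int (K ^ i)"
        by blast
      then have "\<not> diam (A i \<omega>) \<le> int (K ^ i)" "i \<in> {m..m + Suc k}" if "\<omega> \<in> hist n F" for \<omega>
        using that by (auto simp: hist_def n_def)
      then have "slow K m (Suc k) \<inter> hist n F = {}"
        unfolding slow_def by blast
      then show ?thesis by simp
    qed
  qed auto
  then show ?thesis
    using success_bound_bounds[OF K n]
    by (simp add: emeasure_eq_measure ennreal_mult[symmetric] n_def)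
qed

text \<open>Iterates the previous bound, using \<open>1 - q \<le> exp (- q)\<close>.\<close>

lemma prob_slow_le:
  assumes K: "K \<ge> 2" and m: "m \<ge> 1"
  shows "prob (slow K m k) \<le> exp (- (\<Sum>i<k. success_bound K (i + m)))"
proof (induction k)
  case (Suc k)
  have "prob (slow K m (Suc k)) \<le> (1 - success_bound K (m + k)) * prob (slow K m k)"
    by (rule prob_slow_Suc[OF K m])
  also have "\<dots> \<le> exp (- success_bound K (m + k)) * exp (- (\<Sum>i<k. success_bound K (i + m)))"
    using exp_ge_add_one_self[of "- success_bound K (m + k)"] success_bound_bounds[OF K, of "m + k"] m
    by (intro mult_mono Suc.IH) auto
  also have "\<dots> = exp (- (\<Sum>i<Suc k. success_bound K (i + m)))"
    by (simp add: exp_add[symmetric] add.commute)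
  finally show ?case .
qed simp

lemma not_summable_success_bound:
  assumes K: "K \<ge> 2"
  shows "\<not> summable (success_bound K)"
proof
  assume sm: "summable (success_bound K)"
  let ?C = "c * c / ln (3 * real K)"
  have l3: "ln (3 * real K) > 0"
    using K by (intro ln_gt_zero) auto
  have "?C * (1 / (real (n + 1) * ln (real (n + 1)))) \<le> success_bound K n" if n: "n \<ge> 1" for n
  proof -
    have "1 \<le> K ^ Suc n"
      using K by simp
    \<comment> \<open>The crude base \<open>3 * K\<close> absorbs the factor 2 and the summand 1, so
      the logarithm grows at most linearly in \<open>n + 1\<close>.\<close>
    then have "2 * real (K ^ Suc n) + 1 \<le> 3 * real (K ^ Suc n)"
      by linarith
    also have "\<dots> \<le> 3 ^ Suc n * real K ^ Suc n"
      by (intro mult_mono) auto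
    finally have "2 * real (K ^ Suc n) + 1 \<le> (3 * real K) ^ Suc n"
      by (simp only: power_mult_distrib)
    then have "ln (2 * real (K ^ Suc n) + 1) \<le> ln ((3 * real K) ^ Suc n)"
      using K by (subst ln_le_cancel_iff) (auto intro: add_nonneg_pos)
    also have "\<dots> = real (n + 1) * ln (3 * real K)"
      using K by (subst ln_realpow) auto
    finally have l: "ln (2 * real (K ^ Suc n) + 1) \<le> real (n + 1) * ln (3 * real K)" .
    have pos: "ln (2 * real (K ^ Suc n) + 1) > 0" "ln (real (n + 1)) > 0"
      using K n by (auto intro!: ln_gt_zero)
    have "?C * (1 / (real (n + 1) * ln (real (n + 1)))) =
        c / ln (real (n + 1)) * (c / (real (n + 1) * ln (3 * real K)))"
      by (simp add: field_simps)
    also have "\<dots> \<le> success_bound K n"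
      unfolding success_bound_def using c(1) pos l3 l
      by (intro mult_left_mono divide_left_mono mult_pos_pos) auto
    finally show ?thesis .
  qed
  then have "summable (\<lambda>n. ?C * (1 / (real (n + 1) * ln (real (n + 1)))))"
    using c(1) l3 by (intro summable_comparison_test'[OF sm, where N = 1]) auto
  then show False
    using not_summable_inverse_mult_ln c(1) l3 by (subst (asm) summable_cmult_iff) auto
qed

text \<open>If the diameter stayed slow forever from time \<open>m\<close> with positive probability
  \<open>p\<close>, then \<open>- ln p\<close> would bound all partial sums of a divergent
  series.\<close>

lemma AE_not_eventually_slow:
  assumes K: "K \<ge> 2" and m: "m \<ge> 1"
  shows "AE \<omega> in M. \<exists>n\<ge>m. diam (A n \<omega>) > int (K ^ n)"
proof -
  let ?N = "\<Inter>k. slow K m k"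
  have N: "?N \<in> sets M" by (intro sets.countable_INT) auto
  have "prob ?N = 0"
  proof (rule ccontr)
    assume "prob ?N \<noteq> 0"
    then have pos: "prob ?N > 0"
      by (simp add: zero_less_measure_iff)
    have "(\<Sum>i<k. success_bound K (i + m)) \<le> - ln (prob ?N)" for k
    proof -
      have "prob ?N \<le> prob (slow K m k)"
        by (intro finite_measure_mono) auto
      also have "\<dots> \<le> exp (- (\<Sum>i<k. success_bound K (i + m)))"
        by (rule prob_slow_le[OF K m])
      finally have "ln (prob ?N) \<le> - (\<Sum>i<k. success_bound K (i + m))"
        using pos by (metis exp_gt_zero ln_exp ln_le_cancel_iff)
      then show ?thesis by linarith
    qed
    then have "summable (\<lambda>i. success_bound K (i + m))"
      using success_bound_bounds[OF K] m
      by (intro summableI_nonneg_bounded[of _ "- ln (prob ?N)"]) auto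
    then show False
      using not_summable_success_bound[OF K] by (simp add: summable_iff_shift)
  qed
  then have "?N \<in> null_sets M"
    using N by (auto simp: emeasure_eq_measure)
  then show ?thesis
  proof (rule AE_I')
    show "{\<omega> \<in> space M. \<not> (\<exists>n\<ge>m. diam (A n \<omega>) > int (K ^ n))} \<subseteq> ?N"
      by (auto simp: slow_def not_less)
  qed
qed

end

theorem theorem7p3:
  fixes \<xi> :: "int pmf" and M :: "'a measure" and A :: "nat \<Rightarrow> 'a \<Rightarrow> int set"
  assumes "symmetric_walk \<xi>"
    and "aperiodic_walk \<xi>"
    and "log_avoiding \<xi>"
    and "DLA_process \<xi> M A"
  shows "AE \<omega> in M. \<forall>C::real. \<exists>\<^sub>\<infinity>n. real_of_int (diam (A n \<omega>)) > C ^ n"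
proof -
  obtain c where c: "c > 0" "\<And>F x. finite F \<Longrightarrow> card F \<ge> 2 \<Longrightarrow> escape_prob \<xi> F x \<ge> c / ln (real (card F))"
    using assms(3) unfolding log_avoiding_def by blast
  have "prob_space M"
    using assms(4) unfolding DLA_process_def by blast
  then interpret prob_space M .
  interpret log_avoiding_DLA M \<xi> A c
    by unfold_locales (fact assms(1) assms(4) c)+
  \<comment> \<open>Restricting to natural \<open>K\<close> and \<open>m\<close> leaves countably
    many null sets; real \<open>C\<close> is treated afterwards for a fixed outcome.\<close>
  have "AE \<omega> in M. \<forall>K\<in>{2..}. \<forall>m\<in>{1..}. \<exists>n\<ge>m. diam (A n \<omega>) > int (K ^ n)"
    by (intro AE_ball_countable[THEN iffD2] ballI AE_not_eventually_slow) auto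
  then show ?thesis
  proof (eventually_elim, intro allI)
    fix \<omega> and C :: real
    assume *: "\<forall>K\<in>{2..}. \<forall>m\<in>{1..}. \<exists>n\<ge>m. diam (A n \<omega>) > int (K ^ n)"
    \<comment> \<open>Rounding the absolute value of \<open>C\<close> up also covers negative
      \<open>C\<close>, whose even powers are positive.\<close>
    define K where "K = max 2 (nat \<lceil>\<bar>C\<bar>\<rceil>)"
    have CK: "\<bar>C\<bar> \<le> real K"
      unfolding K_def by linarith
    have "\<exists>n\<ge>m. real_of_int (diam (A n \<omega>)) > C ^ n" for m
    proof -
      obtain n where n: "n \<ge> max 1 m" "diam (A n \<omega>) > int (K ^ n)"
        using * by (metis K_def atLeast_iff max.cobounded1)
      have "C ^ n \<le> \<bar>C\<bar> ^ n"
        by (metis abs_ge_self power_abs)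
      also have "\<dots> \<le> real K ^ n"
        using CK by (intro power_mono) auto
      also have "\<dots> = real_of_int (int (K ^ n))"
        by simp
      also have "\<dots> < real_of_int (diam (A n \<omega>))"
        using n(2) by (simp only: of_int_less_iff)
      finally show ?thesis using n(1) by auto
    qed
    then show "\<exists>\<^sub>\<infinity>n. real_of_int (diam (A n \<omega>)) > C ^ n"
      by (simp add: INFM_nat_le)
  qed
qed

end
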